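(* Let $q$ be a prime power. Let $S \subseteq \mathbb{F}_{q^2}^*$ with $S=-S$. Assume that $C^6|S|\leq \frac{q^2-3}{2}$, where $C=|SS|/|S|$. If $A\subseteq \mathbb{F}_{q^2}$ is a clique in the Cayley graph $\operatorname{Cay}(\mathbb{F}_{q^2}; S)$ with $|A|=q$ and $0,1\in A$, then $A$ is the subfield $\mathbb{F}_q$ of $\mathbb{F}_{q^2}$.
   Context: $\mathbb{F}_r$ is the finite field with $r$ elements, $\mathbb{F}_r^*=\mathbb{F}_r\setminus\{0\}$, and $\mathbb{F}_q$ is regarded as the unique subfield of order $q$ of $\mathbb{F}_{q^2}$. Here $-S=\{-s: s\in S\}$ and $SS=\{st: s,t\in S\}$ is the product set. For an abelian group $G$ and $S\subseteq G\setminus\{0\}$ with $S=-S$, the Cayley graph $\operatorname{Cay}(G;S)$ has vertex set $G$, with two vertices adjacent if and only if their difference lies in $S$; here $G$ is the additive group of $\mathbb{F}_{q^2}$. A clique is a set of pairwise adjacent vertices. *)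

theory Defs
  imports
    "HOL-Computational_Algebra.Computational_Algebra"
    "HOL-Number_Theory.Prime_Powers"
    "HOL-Library.Set_Algebras"
    "HOL-Library.Ramsey"
    "HOL-Library.Cardinality"
begin

definition is_subfield :: "'a::field set \<Rightarrow> bool" where
  "is_subfield K \<longleftrightarrow>
     0 \<in> K \<and> 1 \<in> K \<and>
     (\<forall>x\<in>K. \<forall>y\<in>K. x + y \<in> K) \<and> (\<forall>x\<in>K. - x \<in> K) \<and>
     (\<forall>x\<in>K. \<forall>y\<in>K. x * y \<in> K) \<and> (\<forall>x\<in>K. inverse x \<in> K)"

text \<open>The description is proper when the ambient field has \<open>q\<^sup>2\<close> elements with
  \<open>q\<close> a prime power; see \<open>subfield_of_order\<close> below.\<close>

definition subfield_of_order :: "nat \<Rightarrow> 'a::field set" where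
  "subfield_of_order q = (THE K. is_subfield K \<and> card K = q)"

text \<open>Edge set of the Cayley graph on the whole type, as a set of doubletons;
  it is meant for \<open>0 \<notin> S\<close> and \<open>S = uminus ` S\<close>.\<close>

definition cayley_edges :: "'a::ab_group_add set \<Rightarrow> 'a set set" where
  "cayley_edges S = {{x, y} | x y. x - y \<in> S}"

lemma doubleton_in_cayley_edges_iff:
  assumes "S = uminus ` S"
  shows "{x, y} \<in> cayley_edges S \<longleftrightarrow> x - y \<in> S"
proof -
  have "x - y \<in> S" if "y - x \<in> S"
    using that assms by (metis image_eqI minus_diff_eq)
  then show ?thesis
    by (auto simp: cayley_edges_def doubleton_eq_iff)
qed

lemma card_power_linear_roots:
  fixes c d :: "'a::field"
  assumes "q > 1"
  shows "card {x. x ^ q = c * x + d} \<le> q"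
proof -
  let ?p = "monom 1 q - [:d, c:]"
  have deg: "degree [:d, c:] < q" using assms by (simp add: degree_pCons_eq_if)
  have lead: "coeff ?p q = 1" using coeff_eq_0[OF deg] by simp
  then have "?p \<noteq> 0" by (metis coeff_0 zero_neq_one)
  then have "card {x. poly ?p x = 0} \<le> degree ?p" by (rule card_poly_roots_bound)
  also have "degree ?p \<le> q"
    using deg by (intro degree_diff_le) (auto simp: degree_monom_le)
  also have "{x. poly ?p x = 0} = {x. x ^ q = c * x + d}"
    by (auto simp: poly_monom algebra_simps)
  finally show ?thesis .
qed

lemma is_subfield_power_card:
  fixes K :: "'a::finite_field set"
  assumes K: "is_subfield K" and x: "x \<in> K"
  shows "x ^ card K = x"
proof (cases "x = 0")
  case True
  have "card K > 0" using x by (auto simp: card_gt_0_iff)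
  then show ?thesis using True by simp
next
  case False
  have zero: "0 \<in> K" using K by (simp add: is_subfield_def)
  have mult: "a * b \<in> K" if "a \<in> K" "b \<in> K" for a b
    using K that by (simp add: is_subfield_def)
  have inv: "inverse x \<in> K" using K x by (simp add: is_subfield_def)
  have quot: "y / x \<in> K" if "y \<in> K" for y
    using mult[OF that inv] by (simp add: divide_inverse)
  have "(\<Prod>y\<in>K - {0}. x * y) = (\<Prod>y\<in>K - {0}. y)"
    by (rule prod.reindex_bij_witness[of _ "\<lambda>y. y / x" "\<lambda>y. x * y"])
       (use False in \<open>auto intro: mult quot x\<close>)
  then have "x ^ card (K - {0}) * (\<Prod>y\<in>K - {0}. y) = (\<Prod>y\<in>K - {0}. y)"
    by (simp add: prod.distrib)
  then have "x ^ card (K - {0}) = 1" by simp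
  moreover have "card K = Suc (card (K - {0}))"
    using zero by (metis card.remove finite)
  ultimately show ?thesis by simp
qed

lemma ex1_subfield_of_order:
  assumes q: "primepow q" and card: "CARD('a::finite_field) = q\<^sup>2"
  shows "\<exists>!K::'a set. is_subfield K \<and> card K = q"
proof -
  obtain p k where p: "prime p" "k > 0" "q = p ^ k"
    using q by (auto simp: primepow_def)
  have q1: "q > 1" using primepow_gt_Suc_0[OF q] by simp
  have "(\<Sum>x\<in>UNIV. x + 1) = (\<Sum>x\<in>UNIV. x::'a)"
    by (rule sum.reindex_bij_witness[of _ "\<lambda>x. x - 1" "\<lambda>x. x + 1"]) auto
  then have "of_nat CARD('a) = (0::'a)" by (simp add: sum.distrib)
  then have "CHAR('a) dvd q\<^sup>2" by (simp only: of_nat_eq_0_iff_char_dvd card)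
  then have "CHAR('a) dvd p ^ (k * 2)" using p by (simp add: power_mult)
  then have "CHAR('a) dvd p"
    using CHAR_prime prime_dvd_power by blast
  then have char: "CHAR('a) = p"
    using p(1) CHAR_prime primes_dvd_imp_eq by blast
  have add: "(x + y) ^ q = x ^ q + y ^ q" for x y :: 'a
    by (rule freshmans_dream'[of _ k]) (use char p in auto)
  have sub: "(x - y) ^ q = x ^ q - y ^ q" for x y :: 'a
    using add[of "x - y" y] by (simp add: algebra_simps)
  have frob2: "(x ^ q) ^ q = x" for x :: 'a
    using finite_field_power_card_eq_same[of x] card by (simp add: power2_eq_square power_mult)
  define F where "F = {x::'a. x ^ q = x}"
  define f where "f = (\<lambda>x::'a. x ^ q - x)"
  have "card F \<le> q"
    using card_power_linear_roots[OF q1, of 1 "0::'a"] by (simp add: F_def)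
  moreover have "q \<le> card F"
  proof -
    have "range f \<subseteq> {y. y ^ q = (-1) * y + 0}"
      by (auto simp: f_def sub frob2)
    then have im: "card (range f) \<le> q"
      using card_power_linear_roots[OF q1, of "-1" "0::'a"] by (meson card_mono finite le_trans)
    have fib: "card (f -` {y}) \<le> card F" if y: "y \<in> range f" for y
    proof -
      obtain z where z: "y = f z" using y by blast
      show ?thesis
        by (rule card_inj_on_le[of "\<lambda>x. x - z"])
           (auto simp: inj_on_def F_def f_def z sub algebra_simps)
    qed
    have "q * q = card (UNIV::'a set)" using card by (simp add: power2_eq_square)
    also have "(UNIV::'a set) = (\<Union>y\<in>range f. f -` {y})" by auto
    also have "card \<dots> \<le> (\<Sum>y\<in>range f. card (f -` {y}))" by (rule card_UN_le) simp
    also have "\<dots> \<le> card (range f) * card F"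
      using sum_bounded_above[of "range f" "\<lambda>y. card (f -` {y})" "card F"] fib by simp
    also have "\<dots> \<le> q * card F" using im by (rule mult_right_mono) simp
    finally show ?thesis using q1 by simp
  qed
  ultimately have cardF: "card F = q" by simp
  have "is_subfield F"
    using q1 sub[of 0] by (auto simp: is_subfield_def F_def add power_mult_distrib power_inverse)
  moreover have "K = F" if "is_subfield K" "card K = q" for K
  proof (rule card_subset_eq)
    show "K \<subseteq> F" using is_subfield_power_card[OF that(1)] that(2) by (auto simp: F_def)
  qed (use that cardF in auto)
  ultimately show ?thesis using cardF by blast
qed

lemma subfield_of_order:
  assumes "primepow q" and "CARD('a::finite_field) = q\<^sup>2"
  shows "is_subfield (subfield_of_order q :: 'a set)"
    and "card (subfield_of_order q :: 'a set) = q"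
  using theI'[OF ex1_subfield_of_order[OF assms]] by (auto simp: subfield_of_order_def)

end

theory Submission
  imports Defs
begin

text \<open>
  Write \<open>Q = q\<^sup>2\<close> and \<open>p\<close> for the characteristic. For \<open>c \<in> A\<close> let \<open>B\<close> be the set of all
  \<open>1 / (x - c)\<close> with \<open>x \<in> A\<close>, where \<open>1 / 0 = 0\<close>. The differences of \<open>B\<close> lie in
  \<open>S / (S S) \<union> {0}\<close>, so the slopes determined by \<open>B \<times> B\<close> lie in \<open>S S S / (S S S) \<union> {0}\<close>, which by
  the inequalities of Pluennecke (in the form of Petridis) and Ruzsa has at most \<open>(Q - 1) / 2\<close>
  elements. If \<open>y\<close> is not the negative of such a slope, then \<open>b + a y\<close> runs through the whole
  field exactly once for \<open>(a, b) \<in> B \<times> B\<close>; hence the polynomial \<open>\<Sum> (b + a Y)\<^sup>k\<close> has more than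
  \<open>k\<close> zeros when \<open>0 < k \<le> (Q - 1) / 2\<close> and vanishes identically. For \<open>k = j (q + 1)\<close> with
  \<open>0 < j < q / 2\<close> the coefficient of \<open>Y\<^sup>j\<close> is the \<open>(q + 1)\<close>-st power of the \<open>j\<close>-th power sum of
  \<open>B\<close>, so that power sum is zero.

  Let \<open>h = \<Prod> (X - x)\<close> over \<open>x \<in> A\<close>. The power sums of \<open>B\<close> are, up to sign, the Taylor
  coefficients at \<open>c\<close> of the logarithmic derivative of \<open>h / (X - c)\<close>. Hence for \<open>0 < i < q / 2\<close>
  the \<open>(i + 1)\<close>-st Hasse derivative of \<open>h\<close>, multiplied by \<open>i\<close>, vanishes on all of \<open>A\<close>, and
  being of degree less than \<open>q\<close> it is zero. Taking \<open>i = 1\<close> or \<open>i + 1\<close> a power of \<open>p\<close> kills every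
  coefficient of \<open>h\<close> except those of \<open>X\<^sup>q\<close> and \<open>X\<close>, so \<open>h = X\<^sup>q - X\<close>.
\<close>

section \<open>Product set inequalities of Pluennecke-Petridis and Ruzsa\<close>

text \<open>Petridis' argument in multiplicative form: a subset \<open>X\<close> of least expansion
  ratio \<open>K\<close> keeps that ratio after multiplication by any \<open>Z\<close>. The elements
  of \<open>Z\<close> are added one at a time; \<open>0 \<notin> Z\<close> makes each multiplication
  injective.\<close>

lemma petridis:
  fixes X S Z :: "'a::field set"
  assumes X: "finite X" "X \<noteq> {}" and S: "finite S" and Z: "finite Z" "0 \<notin> Z"
    and min: "\<And>Y. Y \<subseteq> X \<Longrightarrow> K * real (card Y) \<le> real (card (Y * S))"
    and eq: "real (card (X * S)) = K * real (card X)"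
  shows "real (card (X * S * Z)) \<le> K * real (card (X * Z))"
  using Z
proof (induction Z rule: finite_induct)
  case empty
  show ?case by (simp add: set_times_def)
next
  case (insert z Z)
  define m where "m = (\<lambda>x. x * z)"
  have z: "z \<noteq> 0" using insert.prems by auto
  have inj: "inj_on m T" for T using z by (auto simp: inj_on_def m_def)
  txt \<open>Passing from \<open>Z\<close> to \<open>insert z Z\<close>, the set \<open>X * Z\<close> gains \<open>(X - W) * z\<close>, while \<open>X * S * Z\<close>
    gains at most \<open>(X * S - Y * S) * z\<close>; minimality of \<open>X\<close> is applied to \<open>Y\<close>.\<close>
  define Y where "Y = {x \<in> X. \<forall>s\<in>S. x * s * z \<in> X * S * Z}"
  define W where "W = {x \<in> X. x * z \<in> X * Z}"
  have "real (card X) > 0" using X by (simp add: card_gt_0_iff)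
  then have K0: "K \<ge> 0" using eq by (metis of_nat_0_le_iff zero_le_mult_iff not_less)
  have WY: "W \<subseteq> Y"
  proof
    fix x assume "x \<in> W"
    then obtain x' z' where x: "x \<in> X" "x' \<in> X" "z' \<in> Z" "x * z = x' * z'"
      by (auto simp: W_def elim!: set_times_elim)
    have "x * s * z \<in> X * S * Z" if "s \<in> S" for s
    proof -
      have "x * s * z = x' * s * z'" using x(4) by (metis mult.assoc mult.commute)
      then show ?thesis using x that by (metis set_times_intro)
    qed
    then show "x \<in> Y" using x by (simp add: Y_def)
  qed
  have fin: "finite (X * S)" "finite (X * S * Z)" "finite (X * Z)" "finite Y" "finite (Y * S)" "finite W"
    using X S insert.hyps by (auto intro!: finite_set_times simp: Y_def W_def)
  have YS: "Y * S \<subseteq> X * S" unfolding Y_def by (auto simp: set_times_def)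
  have "X * S * insert z Z \<subseteq> X * S * Z \<union> m ` (X * S - Y * S)"
  proof
    fix w assume "w \<in> X * S * insert z Z"
    then obtain u v where w: "u \<in> X * S" "v \<in> insert z Z" "w = u * v"
      by (auto elim!: set_times_elim)
    show "w \<in> X * S * Z \<union> m ` (X * S - Y * S)"
    proof (cases "v = z \<and> u \<notin> Y * S")
      case True
      then show ?thesis using w by (auto simp: m_def)
    next
      case False
      then consider "v \<in> Z" | "v = z" "u \<in> Y * S" using w by auto
      then show ?thesis
      proof cases
        case 1
        then show ?thesis using w by auto
      next
        case 2
        then show ?thesis using w(3) by (auto simp: Y_def elim!: set_times_elim)
      qed
    qed
  qed
  then have "card (X * S * insert z Z) \<le> card (X * S * Z \<union> m ` (X * S - Y * S))"
    using fin by (intro card_mono) auto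
  also have "\<dots> \<le> card (X * S * Z) + card (X * S - Y * S)"
    by (metis card_Un_le card_image inj)
  finally have 1: "real (card (X * S * insert z Z)) \<le> real (card (X * S * Z)) + (real (card (X * S)) - real (card (Y * S)))"
    using card_mono[OF fin(1) YS] card_Diff_subset[OF fin(5) YS] by simp
  have "X * insert z Z = X * Z \<union> m ` (X - W)"
    by (auto simp: set_times_def m_def W_def)
  moreover have "X * Z \<inter> m ` (X - W) = {}" by (auto simp: m_def W_def)
  ultimately have "card (X * insert z Z) = card (X * Z) + card (X - W)"
    using fin X by (simp add: card_Un_disjoint card_image[OF inj])
  moreover have "W \<subseteq> X" by (auto simp: W_def)
  ultimately have 2: "real (card (X * insert z Z)) = real (card (X * Z)) + (real (card X) - real (card W))"
    using card_mono[OF X(1) \<open>W \<subseteq> X\<close>] card_Diff_subset[OF fin(6) \<open>W \<subseteq> X\<close>] by simp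
  have IH: "real (card (X * S * Z)) \<le> K * real (card (X * Z))"
    using insert by simp
  have 3: "K * real (card W) \<le> K * real (card Y)"
    using K0 card_mono[OF fin(4) WY] by (simp add: mult_left_mono)
  have "K * real (card Y) \<le> real (card (Y * S))"
    by (rule min) (auto simp: Y_def)
  then show ?case using 1 3 IH eq by (simp add: 2 algebra_simps)
qed

text \<open>Fix one representation of each quotient \<open>r\<close> and scale it by
  \<open>x \<in> X\<close>. The ratio of the resulting pair gives back \<open>r\<close>, and then
  its second entry gives back \<open>x\<close>, so the pairs \<open>(r, x)\<close> embed into
  \<open>(X * V) \<times> (X * W)\<close>.\<close>

lemma ruzsa_triangle:
  fixes X V W :: "'a::field set"
  assumes "finite X" "finite V" "finite W" "0 \<notin> X" "0 \<notin> W"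
  shows "card {v / w | v w. v \<in> V \<and> w \<in> W} * card X \<le> card (X * V) * card (X * W)"
proof -
  define R where "R = {v / w | v w. v \<in> V \<and> w \<in> W}"
  have "\<forall>r\<in>R. \<exists>t. fst t \<in> V \<and> snd t \<in> W \<and> r = fst t / snd t" by (auto simp: R_def)
  from bchoice[OF this] obtain t
    where t: "\<And>r. r \<in> R \<Longrightarrow> fst (t r) \<in> V \<and> snd (t r) \<in> W \<and> r = fst (t r) / snd (t r)"
    by auto
  let ?\<phi> = "\<lambda>(r, x). (x * fst (t r), x * snd (t r))"
  have "inj_on ?\<phi> (R \<times> X)"
  proof (rule inj_onI, clarify)
    fix r x r' x'
    assume h: "r \<in> R" "x \<in> X" "r' \<in> R" "x' \<in> X"
      "x * fst (t r) = x' * fst (t r')" "x * snd (t r) = x' * snd (t r')"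
    have x: "x \<noteq> 0" "x' \<noteq> 0" using h assms by auto
    have "r = (x * fst (t r)) / (x * snd (t r))" using t[OF h(1)] x by simp
    also have "\<dots> = r'" unfolding h(5,6) using t[OF h(3)] x by simp
    finally have "r = r'" .
    moreover have "snd (t r) \<noteq> 0" using t[OF h(1)] assms by auto
    ultimately show "r = r' \<and> x = x'" using h(6) by simp
  qed
  moreover have "?\<phi> ` (R \<times> X) \<subseteq> (X * V) \<times> (X * W)"
    using t by (auto intro!: set_times_intro)
  ultimately have "card (R \<times> X) \<le> card ((X * V) \<times> (X * W))"
    using assms by (intro card_inj_on_le) (auto intro!: finite_set_times)
  then show ?thesis by (simp add: card_cartesian_product R_def)
qed

lemma pluennecke_ruzsa_cube:
  fixes S :: "'a::field set"
  assumes S: "finite S" "0 \<notin> S" "S \<noteq> {}"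
  shows "real (card {v / w | v w. v \<in> S * S * S \<and> w \<in> S * S * S})
    \<le> (real (card (S * S)) / real (card S)) ^ 6 * real (card S)"
proof -
  define F where "F = {X. X \<subseteq> S \<and> X \<noteq> {}}"
  define \<phi> where "\<phi> = (\<lambda>X. real (card (X * S)) / real (card X))"
  have "finite F" "S \<in> F" using S by (auto simp: F_def)
  then obtain X where X: "X \<in> F" and min: "\<And>Y. Y \<in> F \<Longrightarrow> \<phi> X \<le> \<phi> Y"
    using arg_min_if_finite[of F \<phi>] by (metis empty_iff not_le)
  define K where "K = \<phi> X"
  have X': "finite X" "X \<subseteq> S" "0 \<notin> X" "card X > 0"
    using X S by (auto simp: F_def card_gt_0_iff intro: finite_subset)
  have K: "0 \<le> K" "K \<le> real (card (S * S)) / real (card S)"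
    using min[OF \<open>S \<in> F\<close>] by (auto simp: K_def \<phi>_def)
  have eq: "real (card (X * S)) = K * real (card X)"
    using X' by (auto simp: K_def \<phi>_def)
  have le: "K * real (card Y) \<le> real (card (Y * S))" if "Y \<subseteq> X" for Y
  proof (cases "Y = {}")
    case False
    then have "card Y > 0" using that X' by (meson card_gt_0_iff finite_subset)
    moreover have "K \<le> \<phi> Y" unfolding K_def using min that False X' by (auto simp: F_def)
    ultimately show ?thesis by (simp add: \<phi>_def field_simps)
  qed simp
  have pet: "real (card (X * S * Z)) \<le> K * real (card (X * Z))" if "finite Z" "0 \<notin> Z" for Z
    by (rule petridis) (use X' S that le eq in auto)
  have SS: "finite (S * S)" "0 \<notin> S * S" "finite (S * S * S)" "0 \<notin> S * S * S"
    using S by (auto intro!: finite_set_times elim!: set_times_elim)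
  \<comment> \<open>Two uses of \<open>pet\<close>, with \<open>Z = S * S\<close> and
    \<open>Z = S\<close>, and then \<open>eq\<close> contribute one factor \<open>K\<close>
    each.\<close>
  have "real (card (X * (S * S * S))) \<le> K * real (card (X * (S * S)))"
    using pet[OF SS(1,2)] by (simp add: mult.assoc)
  also have "\<dots> \<le> K * (K * real (card (X * S)))"
    using pet[OF S(1,2)] K by (simp add: mult.assoc mult_left_mono)
  finally have 3: "real (card (X * (S * S * S))) \<le> K ^ 3 * real (card X)"
    by (simp add: eq power3_eq_cube mult.assoc)
  let ?R = "{v / w | v w. v \<in> S * S * S \<and> w \<in> S * S * S}"
  have "real (card ?R) * real (card X) \<le> real (card (X * (S * S * S))) * real (card (X * (S * S * S)))"
    using iffD2[OF of_nat_le_iff[where 'a = real] ruzsa_triangle[OF X'(1) SS(3,3) X'(3) SS(4)]]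
    by (simp only: of_nat_mult)
  also have "\<dots> \<le> (K ^ 3 * real (card X)) * (K ^ 3 * real (card X))"
    using 3 K by (intro mult_mono) auto
  also have "\<dots> = (K ^ 6 * real (card X)) * real (card X)"
    by (simp add: power_numeral_reduce)
  finally have "real (card ?R) \<le> K ^ 6 * real (card X)" using X' by simp
  also have "\<dots> \<le> (real (card (S * S)) / real (card S)) ^ 6 * real (card S)"
    using K X' S by (intro mult_mono power_mono) (auto intro: card_mono)
  finally show ?thesis .
qed

section \<open>Power sums and binomial coefficients in finite characteristic\<close>

text \<open>Some nonzero \<open>a\<close> has \<open>a ^ k \<noteq> 1\<close>, because
  \<open>k\<close> is less than the number of nonzero elements. Replacing \<open>x\<close> by
  \<open>a * x\<close> permutes the field and multiplies the sum by \<open>a ^ k\<close>.\<close>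

lemma sum_power_UNIV_eq_0:
  assumes "0 < k" "k < CARD('a::finite_field) - 1"
  shows "(\<Sum>x\<in>UNIV. x ^ k) = (0::'a)"
proof -
  let ?p = "monom 1 k - 1 :: 'a poly"
  have "coeff ?p k = 1" using assms by simp
  then have "?p \<noteq> 0" by (metis coeff_0 zero_neq_one)
  then have "card {x. poly ?p x = 0} \<le> degree ?p" by (rule card_poly_roots_bound)
  also have "\<dots> \<le> k" by (intro degree_diff_le) (auto simp: degree_monom_le)
  finally have "card {x::'a. x ^ k = 1} < card (UNIV - {0::'a})"
    using assms by (simp add: poly_monom)
  then have "\<not> UNIV - {0::'a} \<subseteq> {x. x ^ k = 1}"
    by (meson card_mono finite not_le)
  then obtain a :: 'a where a: "a \<noteq> 0" "a ^ k \<noteq> 1" by auto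
  have "(\<Sum>x\<in>UNIV. (a * x) ^ k) = (\<Sum>x\<in>UNIV. x ^ k)"
    by (rule sum.reindex_bij_witness[of _ "\<lambda>x. x / a" "\<lambda>x. a * x"]) (use a in auto)
  then have "(a ^ k - 1) * (\<Sum>x\<in>UNIV. x ^ k) = 0"
    by (simp add: power_mult_distrib left_diff_distrib flip: sum_distrib_left)
  then show ?thesis using a by simp
qed

text \<open>By Frobenius the power is \<open>(1 + X^P)^d\<close>; the two lowest terms are enough
  for the congruences below.\<close>

lemma linear_power_CHAR_expand:
  assumes "prime CHAR('a::comm_ring_1)" "P = CHAR('a) ^ t"
  shows "\<exists>w. [:1, 1::'a:] ^ (d * P) = 1 + monom (of_nat d) P + monom 1 (2 * P) * w"
proof (induction d)
  case 0
  show ?case by (rule exI[of _ 0]) simp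
next
  case (Suc d)
  then obtain w where w: "[:1, 1::'a:] ^ (d * P) = 1 + monom (of_nat d) P + monom 1 (2 * P) * w" by blast
  have "[:1, 1::'a:] ^ P = (1 + monom 1 1) ^ P" by (simp add: monom_altdef one_pCons)
  also have "\<dots> = 1 ^ P + monom 1 1 ^ P"
    by (rule freshmans_dream'[where n = t]) (use assms in auto)
  also have "\<dots> = 1 + monom 1 P" by (simp add: monom_power)
  finally have "[:1, 1::'a:] ^ (Suc d * P) = (1 + monom 1 P) * (1 + monom (of_nat d) P + monom 1 (2 * P) * w)"
    by (simp add: power_add w)
  also have "\<dots> = 1 + monom (of_nat (Suc d)) P + monom 1 (2 * P) * (monom (of_nat d) 0 + w + monom 1 P * w)"
    by (simp add: algebra_simps mult_monom mult_2 mult_2_right flip: add_monom)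
  finally show ?case by blast
qed

lemma coeff_linear_power_choose: "coeff ([:c, 1:] ^ k) i = of_nat (k choose i) * (c::'a::comm_semiring_1) ^ (k - i)"
proof (cases "i \<le> k")
  case True
  then show ?thesis by (simp add: coeff_linear_poly_power)
next
  case False
  have "degree ([:c, 1:] ^ k) \<le> degree [:c, 1:] * k" by (rule degree_power_le)
  also have "\<dots> \<le> k" by simp
  finally show ?thesis using False by (simp add: coeff_eq_0 binomial_eq_0)
qed

text \<open>Two cases of Lucas' theorem, read off from the coefficients of
  \<open>(1 + X)^(d P) (1 + X)^r\<close>.\<close>

lemma of_nat_choose_CHAR_power:
  assumes "prime CHAR('a::comm_ring_1)" "P = CHAR('a) ^ t"
  shows "s < P \<Longrightarrow> of_nat ((d * P + r) choose s) = (of_nat (r choose s) :: 'a)"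
    and "r < P \<Longrightarrow> of_nat ((d * P + r) choose P) = (of_nat d :: 'a)"
proof -
  obtain w where w: "[:1, 1::'a:] ^ (d * P) = 1 + monom (of_nat d) P + monom 1 (2 * P) * w"
    using linear_power_CHAR_expand[OF assms] by blast
  define u where "u = [:1, 1::'a:] ^ r"
  have *: "[:1, 1::'a:] ^ (d * P + r) = u + monom (of_nat d) P * u + monom 1 (2 * P) * (w * u)"
    unfolding power_add w u_def by (simp add: algebra_simps)
  have c: "of_nat ((d * P + r) choose s) = coeff u s + coeff (monom (of_nat d) P * u) s
      + coeff (monom 1 (2 * P) * (w * u)) s" for s
    using arg_cong[OF *, of "\<lambda>p. coeff p s"] by (simp add: coeff_linear_power_choose)
  have u: "coeff u s = of_nat (r choose s)" for s
    by (simp add: u_def coeff_linear_power_choose)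
  have "P > 0" using assms by (simp add: prime_gt_0_nat)
  then show "s < P \<Longrightarrow> of_nat ((d * P + r) choose s) = (of_nat (r choose s) :: 'a)"
    and "r < P \<Longrightarrow> of_nat ((d * P + r) choose P) = (of_nat d :: 'a)"
    by (simp_all only: c coeff_monom_mult) (simp_all add: u binomial_eq_0)
qed

lemma power_sum_eq_0_of_few_directions:
  fixes B :: "'a::finite_field set"
  assumes q: "q = CHAR('a) ^ n" and Q: "CARD('a) = q\<^sup>2" and B: "card B = q"
    and D: "2 * card {y. \<not> inj_on (\<lambda>(a, b). b + a * y) (B \<times> B)} < CARD('a)"
    and j: "0 < j" "2 * j < q"
  shows "(\<Sum>b\<in>B. b ^ j) = 0"
proof -
  define D where "D = {y. \<not> inj_on (\<lambda>(a, b). b + a * y) (B \<times> B)}"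
  define \<pi> where "\<pi> i = (\<Sum>b\<in>B. b ^ i)" for i
  \<comment> \<open>This \<open>k\<close> is at most \<open>(q\<^sup>2 - 1) / 2\<close>: small
    enough for the power sum over the field to vanish and for \<open>P\<close> to have more roots
    than its degree allows.\<close>
  define k where "k = j * q + j"
  define P where "P = (\<Sum>i\<le>k. monom (of_nat (k choose i) * \<pi> i * \<pi> (k - i)) i)"
  have "2 * k = (2 * j) * (q + 1)" by (simp add: k_def)
  also have "\<dots> \<le> (q - 1) * (q + 1)" using j by (intro mult_right_mono) auto
  also have "\<dots> = q\<^sup>2 - 1" by (simp add: power2_eq_square algebra_simps)
  finally have k: "2 * k \<le> q\<^sup>2 - 1" "0 < k" using j by (auto simp: k_def)
  have q2: "1 < q\<^sup>2" using j one_less_power[of q 2] by simp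
  have root: "poly P y = 0" if "y \<notin> D" for y
  proof -
    let ?f = "\<lambda>(a, b). b + a * y"
    have inj: "inj_on ?f (B \<times> B)" using that by (simp add: D_def)
    have "card (?f ` (B \<times> B)) = CARD('a)"
      by (simp add: card_image[OF inj] card_cartesian_product B Q power2_eq_square)
    then have "?f ` (B \<times> B) = UNIV" by (intro card_subset_eq) auto
    then have "0 = (\<Sum>z\<in>?f ` (B \<times> B). z ^ k)"
      using sum_power_UNIV_eq_0[where 'a = 'a, of k] k q2 Q by simp
    also have "\<dots> = (\<Sum>(a, b)\<in>B \<times> B. (b + a * y) ^ k)"
      by (subst sum.reindex[OF inj]) (simp add: case_prod_unfold)
    also have "\<dots> = (\<Sum>a\<in>B. \<Sum>b\<in>B. \<Sum>i\<le>k. of_nat (k choose i) * (a * y) ^ i * b ^ (k - i))"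
      by (subst add.commute) (simp only: binomial_ring sum.cartesian_product[symmetric])
    also have "\<dots> = (\<Sum>a\<in>B. \<Sum>i\<le>k. \<Sum>b\<in>B. of_nat (k choose i) * (a * y) ^ i * b ^ (k - i))"
      by (intro sum.cong refl sum.swap)
    also have "\<dots> = (\<Sum>i\<le>k. \<Sum>a\<in>B. \<Sum>b\<in>B. of_nat (k choose i) * (a * y) ^ i * b ^ (k - i))"
      by (rule sum.swap)
    also have "\<dots> = poly P y"
    proof -
      have "(\<Sum>a\<in>B. \<Sum>b\<in>B. of_nat (k choose i) * (a * y) ^ i * b ^ (k - i))
          = of_nat (k choose i) * \<pi> i * \<pi> (k - i) * y ^ i" for i
      proof -
        have "(\<Sum>a\<in>B. of_nat (k choose i) * (a * y) ^ i) = of_nat (k choose i) * \<pi> i * y ^ i"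
          by (simp add: \<pi>_def power_mult_distrib sum_distrib_left sum_distrib_right mult.assoc)
        then show ?thesis unfolding \<pi>_def sum_product[symmetric] by (simp add: mult_ac)
      qed
      then show ?thesis by (simp add: P_def poly_sum poly_monom)
    qed
    finally show ?thesis by simp
  qed
  have "P = 0"
  proof (rule ccontr)
    assume "P \<noteq> 0"
    then have "card {y. poly P y = 0} \<le> degree P" by (rule card_poly_roots_bound)
    also have "\<dots> \<le> k" unfolding P_def
      by (intro degree_sum_le) (auto intro: order.trans[OF degree_monom_le])
    finally have "card {y. poly P y = 0} \<le> k" .
    moreover have "card (UNIV - D) \<le> card {y. poly P y = 0}"
      using root by (intro card_mono) auto
    moreover have "card (UNIV - D) = q\<^sup>2 - card D" by (simp add: card_Diff_subset Q)
    ultimately show False using k D Q q2 unfolding D_def[symmetric] by linarith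
  qed
  \<comment> \<open>At \<open>Y^j\<close> Lucas gives the binomial coefficient
    \<open>j choose j = 1\<close>, and Frobenius turns the complementary power sum, of exponent
    \<open>j * q\<close>, into \<open>\<pi> j ^ q\<close>.\<close>
  moreover have "coeff P j = of_nat (k choose j) * \<pi> j * \<pi> (k - j)"
    by (simp add: P_def coeff_sum k_def if_distrib cong: if_cong)
  moreover have "of_nat (k choose j) = (1::'a)"
    unfolding k_def using of_nat_choose_CHAR_power(1)[OF CHAR_prime q, of j j j] j by simp
  moreover have "\<pi> (k - j) = \<pi> j ^ q"
    unfolding \<pi>_def using freshmans_dream_sum'[OF CHAR_prime q, of "\<lambda>b. b ^ j" B] by (simp add: k_def power_mult)
  ultimately have "\<pi> j * \<pi> j ^ q = 0" by simp
  then show ?thesis by (auto simp: \<pi>_def)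
qed

section \<open>From power sums of reciprocals to coefficients\<close>

text \<open>Newton's identities through the logarithmic derivative: \<open>pderiv g\<close> is
  \<open>g\<close> times the sum of the \<open>1 / (X - d)\<close>, whose expansion at 0 has the
  power sums as coefficients up to sign. So \<open>X^J\<close> divides \<open>pderiv g\<close>. The
  factor \<open>i\<close> comes from differentiation and may vanish in the field.\<close>

lemma coeff_prod_linear_eq_0_of_power_sums:
  fixes D :: "'a::field set"
  assumes D: "finite D" "0 \<notin> D" and sums: "\<And>l. 0 < l \<Longrightarrow> l \<le> J \<Longrightarrow> (\<Sum>d\<in>D. inverse d ^ l) = 0"
    and i: "0 < i" "i \<le> J"
  shows "of_nat i * coeff (\<Prod>d\<in>D. [:- d, 1:]) i = 0"
proof -
  define g where "g = (\<Prod>d\<in>D. [:- d, 1:])"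
  define g' where "g' d = (\<Prod>e\<in>D - {d}. [:- e, 1:])" for d
  have g: "g = [:- d, 1:] * g' d" if "d \<in> D" for d
    unfolding g_def g'_def using D(1) that by (rule prod.remove)
  \<comment> \<open>The geometric series of \<open>1 / (X - d)\<close> with remainder, multiplied by
    \<open>g\<close>; it comes from factoring \<open>X^J - d^J\<close>.\<close>
  have expand: "g' d = monom 1 J * (smult (inverse d ^ J) (g' d)) - g * (\<Sum>l<J. monom (inverse d ^ Suc l) l)"
    if d: "d \<in> D" for d
  proof -
    have d0: "d \<noteq> 0" using d D by auto
    have "monom 1 J - [:d:] ^ J = (monom 1 1 - [:d:]) * (\<Sum>l<J. [:d:] ^ (J - Suc l) * monom 1 1 ^ l)"
      using power_diff_sumr2[of "monom 1 1" J "[:d:]"] by (simp add: monom_power)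
    also have "monom 1 1 - [:d:] = [:- d, 1:]" by (simp add: monom_altdef)
    also have "(\<Sum>l<J. [:d:] ^ (J - Suc l) * monom 1 1 ^ l) = smult (d ^ J) (\<Sum>l<J. monom (inverse d ^ Suc l) l)"
    proof -
      have "[:d:] ^ (J - Suc l) * monom 1 1 ^ l = smult (d ^ J) (monom (inverse d ^ Suc l) l)" if "l < J" for l
      proof -
        have "d ^ J = d ^ (J - Suc l) * d ^ Suc l" using that by (simp flip: power_add del: power_Suc)
        then have "d ^ J * inverse d ^ Suc l = d ^ (J - Suc l)" using d0 by (simp add: power_inverse del: power_Suc)
        then show ?thesis by (simp add: monom_power smult_monom poly_const_pow del: power_Suc)
      qed
      then have "(\<Sum>l<J. [:d:] ^ (J - Suc l) * monom 1 1 ^ l) = (\<Sum>l<J. smult (d ^ J) (monom (inverse d ^ Suc l) l))"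
        by (intro sum.cong) auto
      also have "\<dots> = smult (d ^ J) (\<Sum>l<J. monom (inverse d ^ Suc l) l)"
        by (intro poly_eqI) (simp only: coeff_sum coeff_smult sum_distrib_left)
      finally show ?thesis .
    qed
    finally have "[:d:] ^ J = monom 1 J - smult (d ^ J) ([:- d, 1:] * (\<Sum>l<J. monom (inverse d ^ Suc l) l))"
      by (simp add: algebra_simps)
    from arg_cong[OF this, of "\<lambda>u. u * g' d"]
    have "[:d ^ J:] * g' d = monom 1 J * g' d
        - smult (d ^ J) (g * (\<Sum>l<J. monom (inverse d ^ Suc l) l))"
      unfolding g[OF d] poly_const_pow left_diff_distrib mult_smult_left by (simp only: mult_ac)
    then have "smult (inverse (d ^ J)) ([:d ^ J:] * g' d)
        = smult (inverse (d ^ J)) (monom 1 J * g' d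
            - smult (d ^ J) (g * (\<Sum>l<J. monom (inverse d ^ Suc l) l)))"
      by simp
    then show ?thesis using d0 by (simp add: smult_diff_right power_inverse)
  qed
  have "pderiv g = (\<Sum>d\<in>D. g' d)"
    by (simp add: g_def g'_def pderiv_prod pderiv_pCons)
  also have "\<dots> = monom 1 J * (\<Sum>d\<in>D. smult (inverse d ^ J) (g' d))
      - g * (\<Sum>d\<in>D. \<Sum>l<J. monom (inverse d ^ Suc l) l)"
    by (subst sum.cong[OF refl expand]) (simp_all add: sum_subtractf sum_distrib_left)
  also have "(\<Sum>d\<in>D. \<Sum>l<J. monom (inverse d ^ Suc l) l) = (\<Sum>l<J. monom (\<Sum>d\<in>D. inverse d ^ Suc l) l)"
    by (subst sum.swap) (simp add: monom_sum)
  also have "\<dots> = 0" using sums by (intro sum.neutral) (auto simp del: power_Suc)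
  finally have "coeff (pderiv g) (i - 1) = 0"
    using i by (simp add: coeff_monom_mult)
  then show ?thesis using i by (simp add: coeff_pderiv g_def)
qed

text \<open>The right-hand side is the \<open>i\<close>-th Hasse derivative of \<open>h\<close> at
  \<open>c\<close>.\<close>

lemma coeff_pcompose_linear:
  fixes h :: "'a::comm_ring_1 poly"
  shows "coeff (h \<circ>\<^sub>p [:c, 1:]) i = (\<Sum>k\<le>degree h. coeff h k * of_nat (k choose i) * c ^ (k - i))"
proof -
  have "h \<circ>\<^sub>p [:c, 1:] = (\<Sum>k\<le>degree h. monom (coeff h k) k) \<circ>\<^sub>p [:c, 1:]"
    by (simp add: poly_as_sum_of_monoms)
  also have "\<dots> = (\<Sum>k\<le>degree h. smult (coeff h k) ([:c, 1:] ^ k))"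
  proof -
    have "[:0, 1:] ^ k \<circ>\<^sub>p [:c, 1:] = [:c, 1::'a:] ^ k" for k
      by (induction k) (simp_all add: pcompose_mult pcompose_pCons pcompose_1)
    then show ?thesis by (simp add: pcompose_sum monom_altdef pcompose_smult)
  qed
  finally show ?thesis by (simp add: coeff_sum coeff_linear_power_choose mult.assoc)
qed

lemma coeff_prod_linear_choose_eq_0:
  fixes A :: "'a::field set"
  assumes A: "finite A"
    and sums: "\<And>c l. c \<in> A \<Longrightarrow> 0 < l \<Longrightarrow> l \<le> J \<Longrightarrow> (\<Sum>x\<in>A - {c}. inverse (x - c) ^ l) = 0"
    and i: "0 < i" "i \<le> J" and k: "i < k"
  shows "of_nat i * of_nat (k choose Suc i) * coeff (\<Prod>x\<in>A. [:- x, 1:]) k = 0"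
proof -
  define h where "h = (\<Prod>x\<in>A. [:- x, 1:])"
  \<comment> \<open>\<open>H\<close> is \<open>i\<close> times the Hasse derivative of order
    \<open>i + 1\<close> of \<open>h\<close>.\<close>
  define H where "H = (\<Sum>k\<in>{Suc i..degree h}. monom (of_nat i * of_nat (k choose Suc i) * coeff h k) (k - Suc i))"
  have deg: "degree h = card A" unfolding h_def by (subst degree_prod_sum_eq) auto
  have root: "poly H c = 0" if c: "c \<in> A" for c
  proof -
    define D where "D = (\<lambda>x. x - c) ` (A - {c})"
    have inj: "inj_on (\<lambda>x. x - c) (A - {c})" by (auto simp: inj_on_def)
    have "h \<circ>\<^sub>p [:c, 1:] = (\<Prod>x\<in>A. [:c - x, 1:])"
      by (simp add: h_def pcompose_prod pcompose_pCons)
    also have "\<dots> = [:0, 1:] * (\<Prod>x\<in>A - {c}. [:c - x, 1:])"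
      using prod.remove[OF A c, of "\<lambda>x. [:c - x, 1:]"] by simp
    also have "(\<Prod>x\<in>A - {c}. [:c - x, 1:]) = (\<Prod>d\<in>D. [:- d, 1:])"
      unfolding D_def by (simp add: prod.reindex[OF inj])
    finally have "coeff (h \<circ>\<^sub>p [:c, 1:]) (Suc i) = coeff (\<Prod>d\<in>D. [:- d, 1:]) i" by simp
    moreover have "of_nat i * coeff (\<Prod>d\<in>D. [:- d, 1:]) i = 0"
      by (rule coeff_prod_linear_eq_0_of_power_sums[OF _ _ _ i])
         (use A sums[OF c] in \<open>auto simp: D_def sum.reindex[OF inj]\<close>)
    moreover have "poly H c = of_nat i * coeff (h \<circ>\<^sub>p [:c, 1:]) (Suc i)"
      unfolding coeff_pcompose_linear sum_distrib_left H_def poly_sum poly_monom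
      by (rule sum.mono_neutral_cong_left) (auto simp: binomial_eq_0 mult_ac)
    ultimately show ?thesis by simp
  qed
  have "H = 0"
  proof (rule ccontr)
    assume H: "H \<noteq> 0"
    \<comment> \<open>For empty \<open>A\<close> the sum defining \<open>H\<close> is empty.
      Nonemptiness makes \<open>card A - Suc i\<close> strictly smaller than
      \<open>card A\<close>.\<close>
    then have "A \<noteq> {}" using A by (auto simp: H_def h_def)
    then have "card A > 0" using A by auto
    have "card A \<le> card {x. poly H x = 0}"
      using root poly_roots_finite[OF H] by (intro card_mono) auto
    also have "\<dots> \<le> degree H" using H by (rule card_poly_roots_bound)
    also have "\<dots> \<le> card A - Suc i" unfolding H_def
      by (intro degree_sum_le) (auto intro: order.trans[OF degree_monom_le] simp: deg)
    finally show False using \<open>card A > 0\<close> by simp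
  qed
  have "coeff H (k - Suc i) = (if k \<le> degree h then of_nat i * of_nat (k choose Suc i) * coeff h k else 0)"
  proof -
    have "coeff H (k - Suc i) = (\<Sum>k'\<in>{Suc i..degree h}. if k' = k then of_nat i * of_nat (k choose Suc i) * coeff h k else 0)"
      unfolding H_def coeff_sum using k by (intro sum.cong) auto
    then show ?thesis using k by simp
  qed
  then show ?thesis using \<open>H = 0\<close> by (auto simp: h_def[symmetric] coeff_eq_0 split: if_splits)
qed


lemma primepow_eq_CHAR_power:
  assumes q: "primepow q" and Q: "CARD('a::finite_field) = q\<^sup>2"
  obtains n where "q = CHAR('a) ^ n"
proof -
  obtain p n where p: "prime p" "n > 0" "q = p ^ n" using q by (auto simp: primepow_def)
  \<comment> \<open>Translation invariance of the sum over the field shows that its order is zero in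
    it.\<close>
  have "(\<Sum>x\<in>UNIV. x + 1) = (\<Sum>x\<in>UNIV. x::'a)"
    by (rule sum.reindex_bij_witness[of _ "\<lambda>x. x - 1" "\<lambda>x. x + 1"]) auto
  then have "of_nat CARD('a) = (0::'a)" by (simp add: sum.distrib)
  then have "CHAR('a) dvd p ^ (n * 2)"
    by (simp only: of_nat_eq_0_iff_char_dvd Q p power_mult)
  then have "CHAR('a) = p"
    using p(1) CHAR_prime prime_dvd_power primes_dvd_imp_eq by metis
  then show ?thesis using that p by blast
qed

text \<open>For each \<open>k\<close> some admissible \<open>i\<close> makes
  \<open>i * (k choose Suc i)\<close> nonzero in the field: \<open>i = 1\<close> if \<open>k\<close>
  is below the characteristic \<open>p\<close>, otherwise \<open>i = P - 1\<close> with
  \<open>P\<close> the largest power of \<open>p\<close> up to \<open>k\<close>. Then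
  \<open>i\<close> is \<open>-1\<close> and the binomial coefficient is the leading digit of
  \<open>k\<close> in base \<open>p\<close>.\<close>

lemma coeff_prod_linear_middle_eq_0:
  fixes A :: "'a::field set"
  assumes char: "prime CHAR('a)" and q: "q = CHAR('a) ^ n" and A: "finite A"
    and sums: "\<And>c l. c \<in> A \<Longrightarrow> 0 < l \<Longrightarrow> 2 * l < q \<Longrightarrow> (\<Sum>x\<in>A - {c}. inverse (x - c) ^ l) = 0"
    and k: "2 \<le> k" "k < q"
  shows "coeff (\<Prod>x\<in>A. [:- x, 1:]) k = 0"
proof -
  let ?p = "CHAR('a)"
  have p1: "?p > 1" using char by (rule prime_gt_1_nat)
  have vanish: "coeff (\<Prod>x\<in>A. [:- x, 1:]) k = 0"
    if i: "0 < i" "2 * i < q" "i < k" and ne: "of_nat i * of_nat (k choose Suc i) \<noteq> (0::'a)" for i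
  proof -
    have "of_nat i * of_nat (k choose Suc i) * coeff (\<Prod>x\<in>A. [:- x, 1:]) k = 0"
      by (rule coeff_prod_linear_choose_eq_0[OF A, of "i"]) (use sums i in auto)
    then show ?thesis using ne by simp
  qed
  show ?thesis
  proof (cases "k < ?p")
    case True
    have "even (k * (k - 1))" using k by (cases "even k") auto
    then have "2 * (k choose 2) = k * (k - 1)" by (simp add: choose_two)
    moreover have "\<not> ?p dvd k * (k - 1)"
      using True k char by (auto simp: prime_dvd_mult_iff dest: dvd_imp_le)
    ultimately have "\<not> ?p dvd (k choose 2)" by (metis dvd_mult)
    then have "of_nat 1 * of_nat (k choose Suc 1) \<noteq> (0::'a)"
      by (simp add: of_nat_eq_0_iff_char_dvd numeral_2_eq_2)
    then show ?thesis using vanish[of 1] k True by simp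
  next
    case False
    obtain t where t: "?p ^ t \<le> k" "k < ?p ^ Suc t"
      using ex_power_ivl1[of ?p k] p1 k by auto
    define P where "P = ?p ^ t"
    have "t \<noteq> 0" using t False by (intro notI) simp
    then obtain P' where P': "P = ?p * P'" unfolding P_def by (cases t) auto
    have P: "P > 1" using p1 \<open>t \<noteq> 0\<close> one_less_power[of ?p t] by (simp add: P_def)
    \<comment> \<open>As \<open>q\<close> is itself a power of \<open>p\<close>, a smaller power
      satisfies \<open>p * P \<le> q\<close>; this puts \<open>P - 1\<close> below
      \<open>q / 2\<close>.\<close>
    have "?p ^ t < ?p ^ n" using t k q by simp
    then have "t < n" using p1 by simp
    then have "?p ^ Suc t \<le> q" unfolding q using p1 by (intro power_increasing) auto
    then have "?p * P \<le> q" by (simp add: P_def)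
    moreover have "2 * P \<le> ?p * P" using p1 by (intro mult_right_mono) auto
    ultimately have Pq: "2 * P \<le> q" by (rule order.trans[rotated])
    define d where "d = k div P"
    have kd: "k = d * P + k mod P" by (simp add: d_def)
    have "d < ?p" unfolding d_def using t(2) P by (simp add: P_def less_mult_imp_div_less)
    moreover have "d > 0" unfolding d_def using t(1) p1 by (simp add: P_def div_greater_zero_iff)
    ultimately have d: "\<not> ?p dvd d" by (auto dest: dvd_imp_le)
    have "of_nat (k choose P) = (of_nat d :: 'a)"
      using of_nat_choose_CHAR_power(2)[OF char P_def, of "k mod P" d] kd P by simp
    moreover have "of_nat d \<noteq> (0::'a)" using d by (simp add: of_nat_eq_0_iff_char_dvd)
    moreover have "of_nat P = (0::'a)" by (simp add: P')
    ultimately have "of_nat (P - 1) * of_nat (k choose Suc (P - 1)) \<noteq> (0::'a)"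
      using P by (simp add: of_nat_diff)
    then show ?thesis using vanish[of "P - 1"] P Pq t(1) by (simp add: P_def)
  qed
qed

section \<open>Directions determined by the inverted clique\<close>

text \<open>Differences of reciprocals have the form \<open>s / (t * u)\<close> with entries in
  \<open>S\<close>, so a quotient of two of them lies in \<open>SSS / SSS\<close>. The
  \<open>Suc\<close> accounts for \<open>y = 0\<close>.\<close>

lemma card_inverse_shift_directions_le:
  fixes S A :: "'a::finite_field set"
  assumes S: "0 \<notin> S" and A: "\<And>x y. x \<in> A \<Longrightarrow> y \<in> A \<Longrightarrow> x \<noteq> y \<Longrightarrow> x - y \<in> S" and c: "c \<in> A"
  defines "B \<equiv> (\<lambda>x. inverse (x - c)) ` A"
  shows "card {y. \<not> inj_on (\<lambda>(a, b). b + a * y) (B \<times> B)}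
    \<le> Suc (card {v / w | v w. v \<in> S * S * S \<and> w \<in> S * S * S})"
proof -
  let ?R = "{v / w | v w. v \<in> S * S * S \<and> w \<in> S * S * S}"
  have diff: "\<exists>s\<in>S. \<exists>t\<in>S. \<exists>u\<in>S. a - a' = s / (t * u)" if aa: "a \<in> B" "a' \<in> B" "a \<noteq> a'" for a a'
  proof -
    obtain x where "x \<in> A" "a = inverse (x - c)" using aa(1) unfolding B_def by blast
    moreover obtain x' where "x' \<in> A" "a' = inverse (x' - c)" using aa(2) unfolding B_def by blast
    ultimately have x: "x \<in> A" "x' \<in> A" "a = inverse (x - c)" "a' = inverse (x' - c)" "x \<noteq> x'"
      using aa(3) by auto
    have xS: "x' - x \<in> S" "x - x' \<in> S" using A x by auto
    have inv: "inverse w = w / (w * w)" if "w \<noteq> 0" for w :: 'a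
      using that by (simp add: divide_simps)
    have inv_diff: "inverse u - inverse w = (w - u) / (u * w)" if "u \<noteq> 0" "w \<noteq> 0" for u w :: 'a
      using that by (simp add: field_simps)
    \<comment> \<open>The point \<open>c\<close> goes to \<open>inverse 0 = 0\<close>; writing
      \<open>1 / w\<close> as \<open>w / (w * w)\<close> brings these cases to the same
      shape.\<close>
    consider "x = c" | "x' = c" | "x \<noteq> c" "x' \<noteq> c" by blast
    then show ?thesis
    proof cases
      case 1
      then have "a - a' = - inverse (x' - c)" using x by simp
      also have "\<dots> = - ((x' - c) / ((x' - c) * (x' - c)))"
        by (subst inv) (use 1 x in auto)
      also have "\<dots> = (c - x') / ((x' - c) * (x' - c))"
        by (simp only: minus_divide_left minus_diff_eq)
      finally show ?thesis using 1 xS by blast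
    next
      case 2
      then have "a - a' = inverse (x - c)" using x by simp
      also have "\<dots> = (x - c) / ((x - c) * (x - c))"
        by (rule inv) (use 2 x in auto)
      finally show ?thesis using 2 xS by blast
    next
      case 3
      then have "a - a' = ((x' - c) - (x - c)) / ((x - c) * (x' - c))"
        unfolding x(3,4) by (intro inv_diff) auto
      also have "(x' - c) - (x - c) = x' - x" by simp
      finally show ?thesis using 3 xS A c x by blast
    qed
  qed
  have "{y. \<not> inj_on (\<lambda>(a, b). b + a * y) (B \<times> B)} \<subseteq> insert 0 ?R"
  proof
    fix y assume "y \<in> {y. \<not> inj_on (\<lambda>(a, b). b + a * y) (B \<times> B)}"
    then obtain a b a' b' where B: "a \<in> B" "b \<in> B" "a' \<in> B" "b' \<in> B"
      and ne: "(a, b) \<noteq> (a', b')" and eq: "b + a * y = b' + a' * y"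
      by (auto simp: inj_on_def)
    have y: "(a - a') * y = b' - b" using eq by (simp add: algebra_simps)
    show "y \<in> insert 0 ?R"
    proof (cases "y = 0")
      case False
      then have "a \<noteq> a'" "b' \<noteq> b" using y ne by auto
      then obtain s t u s' t' u' where h: "s \<in> S" "t \<in> S" "u \<in> S" "s' \<in> S" "t' \<in> S" "u' \<in> S"
        "a - a' = s / (t * u)" "b' - b = s' / (t' * u')"
        using diff B by metis
      have nz: "s \<noteq> 0" "t \<noteq> 0" "u \<noteq> 0" "t' \<noteq> 0" "u' \<noteq> 0" using h S by auto
      have "y = (s' * t * u) / (s * t' * u')"
        using y nz unfolding h(7,8) by (simp add: field_simps)
      moreover have "s' * t * u \<in> S * S * S" "s * t' * u' \<in> S * S * S"
        using h by (auto intro!: set_times_intro)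
      ultimately show ?thesis by blast
    qed simp
  qed
  then have "card {y. \<not> inj_on (\<lambda>(a, b). b + a * y) (B \<times> B)} \<le> card (insert 0 ?R)"
    by (intro card_mono) auto
  also have "\<dots> \<le> Suc (card ?R)" by (rule card_insert_le_m1) auto
  finally show ?thesis .
qed

section \<open>Identification of the clique with the subfield\<close>

theorem corollary1p2:
  fixes q :: nat and S A :: "'a::finite_field set" and C :: real
  assumes "primepow q"
    and "CARD('a) = q\<^sup>2"
    and "S \<subseteq> UNIV - {0}"
    and "S = uminus ` S"
    and "C = real (card (S * S)) / real (card S)"
    and "C ^ 6 * real (card S) \<le> ((real q)\<^sup>2 - 3) / 2"
    and "clique A (cayley_edges S)"
    and "card A = q"
    and "0 \<in> A" and "1 \<in> A"
  shows "A = subfield_of_order q"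
proof -
  obtain n where n: "q = CHAR('a) ^ n"
    using primepow_eq_CHAR_power[OF assms(1,2)] .
  have q1: "q > 1" using primepow_gt_Suc_0[OF assms(1)] by simp
  have S0: "0 \<notin> S" using assms(3) by auto
  have AS: "x - y \<in> S" if "x \<in> A" "y \<in> A" "x \<noteq> y" for x y
    using assms(7) that doubleton_in_cayley_edges_iff[OF assms(4)] unfolding clique_def by blast
  have "1 - 0 \<in> S" using AS[OF assms(10,9)] by simp
  then have "S \<noteq> {}" by auto
  let ?R = "{v / w | v w. v \<in> S * S * S \<and> w \<in> S * S * S}"
  have "real (card ?R) \<le> ((real q)\<^sup>2 - 3) / 2"
    using pluennecke_ruzsa_cube[OF _ S0 \<open>S \<noteq> {}\<close>] assms(5,6) by simp
  then have "real (2 * card ?R + 3) \<le> real (q\<^sup>2)" by simp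
  \<comment> \<open>The slack of 3 absorbs the extra direction 0: \<open>2 * Suc (card ?R)\<close>
    is still less than \<open>q\<^sup>2\<close>.\<close>
  then have R: "2 * card ?R + 3 \<le> q\<^sup>2" by (simp only: of_nat_le_iff)
  have sums: "(\<Sum>x\<in>A - {c}. inverse (x - c) ^ l) = 0" if c: "c \<in> A" and l: "0 < l" "2 * l < q" for c l
  proof -
    let ?B = "(\<lambda>x. inverse (x - c)) ` A"
    have inj: "inj_on (\<lambda>x. inverse (x - c)) A" by (auto simp: inj_on_def)
    have "(\<Sum>b\<in>?B. b ^ l) = 0"
    proof (rule power_sum_eq_0_of_few_directions[OF n assms(2) _ _ l])
      show "card ?B = q" using assms(8) by (simp add: card_image[OF inj])
      show "2 * card {y. \<not> inj_on (\<lambda>(a, b). b + a * y) (?B \<times> ?B)} < CARD('a)"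
        using card_inverse_shift_directions_le[OF S0 AS c] R assms(2) by simp
    qed
    then have "(\<Sum>x\<in>A. inverse (x - c) ^ l) = 0" by (simp add: sum.reindex[OF inj])
    \<comment> \<open>The term \<open>x = c\<close> is \<open>0 ^ l\<close>, which is zero since
      \<open>l > 0\<close>.\<close>
    then show ?thesis using l by (simp add: sum.remove[OF _ c] power_0_left)
  qed
  define h where "h = (\<Prod>x\<in>A. [:- x, 1:])"
  have deg: "degree h = q" unfolding h_def by (subst degree_prod_sum_eq) (auto simp: assms(8))
  have root: "poly h x = 0" if "x \<in> A" for x
    using that by (auto simp: h_def poly_prod)
  have mid: "coeff h k = 0" if "2 \<le> k" "k < q" for k
    unfolding h_def by (rule coeff_prod_linear_middle_eq_0[OF CHAR_prime n _ sums that]) auto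
  have h: "h = monom 1 q + monom (coeff h 1) 1"
  proof (rule poly_eqI)
    fix k
    consider "k = 0" | "k = 1" | "2 \<le> k" "k < q" | "k = q" | "k > q" by linarith
    then show "coeff h k = coeff (monom 1 q + monom (coeff h 1) 1) k"
    proof cases
      case 1
      then show ?thesis using root[OF assms(9)] q1 by (simp add: poly_0_coeff_0)
    next
      case 4
      have "lead_coeff h = 1" unfolding h_def by (simp add: lead_coeff_prod)
      then show ?thesis using 4 deg q1 by simp
    qed (use mid q1 deg in \<open>auto simp: coeff_eq_0\<close>)
  qed
  have val: "poly h x = x ^ q + coeff h 1 * x" for x
    by (subst h) (simp add: poly_monom)
  \<comment> \<open>The root 0 has removed the constant term; the root 1 now fixes the linear
    one.\<close>
  have "coeff h 1 = - 1" using root[OF assms(10)] by (simp add: val eq_neg_iff_add_eq_0 add.commute)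
  \<comment> \<open>\<open>A\<close> and the subfield, with \<open>q\<close> elements each, both lie
    in the root set of \<open>X^q - X\<close>, which has at most \<open>q\<close> elements.\<close>
  then have "A \<subseteq> {x. x ^ q = 1 * x + 0}" using root val by auto
  moreover have "subfield_of_order q \<subseteq> {x::'a. x ^ q = 1 * x + 0}"
    using is_subfield_power_card subfield_of_order[OF assms(1,2)] by force
  moreover have "card {x::'a. x ^ q = 1 * x + 0} \<le> q"
    using q1 by (rule card_power_linear_roots)
  ultimately show ?thesis
    using assms(8) subfield_of_order(2)[OF assms(1,2)] by (metis card_seteq finite)
qed

end
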